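(* Let $\mathcal{H}=\mathbb{C}^2$, and let $\mathcal{T}_1=(\xi\otimes\rho_{in},\{I_{anc}\otimes E_m\}_{m\in\Omega_E})$ and $\mathcal{T}_2=(\xi'\otimes\tau_{in},\{I_{anc}\otimes F_n\}_{n\in\Omega_F})$ be two ancilla-free channel measurements, where $\rho_{in},\tau_{in}$ are density operators on $\mathcal{H}$ and $\{E_m\}_{m\in\Omega_E}$, $\{F_n\}_{n\in\Omega_F}$ are POVMs on $\mathcal{H}$. A random unitary channel $\Lambda$ on $\mathcal{H}$ is measured with $\mathcal{T}_1$ with probability $r$ and with $\mathcal{T}_2$ with probability $1-r$; let $p_m(\Lambda)$ and $q_n(\Lambda)$ be the outcome probabilities of $\mathcal{T}_1$ and $\mathcal{T}_2$, respectively. Let $\mathcal{M}\subset\Omega_E$ and $\mathcal{N}\subset\Omega_F$ be arbitrary subsets, and put $E(\mathcal{M}):=\sum_{m\in\mathcal{M}}E_m$, $F(\mathcal{N}):=\sum_{n\in\mathcal{N}}F_n$. Let $|\psi\rangle,|\phi\rangle,|\psi'\rangle,|\phi'\rangle$ be (unit) eigenvectors of the maximum eigenvalue of $\rho_{in},\tau_{in},E(\mathcal{M}),F(\mathcal{N})$, respectively. Define $$C(\mathcal{M},\mathcal{N}):=\max_{\Lambda}\Big(r\sum_{m\in\mathcal{M}}p_m(\Lambda)+(1-r)\sum_{n\in\mathcal{N}}q_n(\Lambda)\Big),$$ $$T(\mathcal{M},\mathcal{N}):=r\max_{\Lambda}\sum_{m\in\mathcal{M}}p_m(\Lambda)+(1-r)\max_{\Lambda}\sum_{n\in\mathcal{N}}q_n(\Lambda),$$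 with all maxima over all random unitary channels $\Lambda$ on $\mathcal{H}$. Then, for $0<r<1$, the quantity $C(\mathcal{M},\mathcal{N})$ gives a nontrivial bound, in the sense that $C(\mathcal{M},\mathcal{N})<T(\mathcal{M},\mathcal{N})$, if and only if $|\langle\psi|\phi\rangle|\neq|\langle\psi'|\phi'\rangle|$.
   Context: A density operator is a linear operator $\rho\ge 0$ with $\operatorname{tr}\rho=1$. A POVM with outcome set $\Omega$ is a family $\{E_m\}_{m\in\Omega}$ of operators with $0\le E_m\le I$ and $\sum_{m\in\Omega}E_m=I$. A random unitary channel on $\mathcal{H}=\mathbb{C}^2$ is a map $\Lambda(\rho)=\sum_x p_xU_x\rho U_x^\dagger$, where $\{p_x\}_x$ is a probability distribution and each $U_x$ is a unitary operator on $\mathcal{H}$. An ancilla-free channel measurement $(\xi\otimes\rho_{in},\{I_{anc}\otimes E_m\}_{m\in\Omega_E})$ consists of a density operator $\xi$ on an ancilla Hilbert space $\mathcal{H}_{anc}$ (with identity operator $I_{anc}$), a density operator $\rho_{in}$ on $\mathcal{H}$, and a POVM $\{E_m\}_{m\in\Omega_E}$ on $\mathcal{H}$. One prepares $\xi\otimes\rho_{in}$, applies $\Lambda$ to $\mathcal{H}$, and measures $\{I_{anc}\otimes E_m\}$. The probability of outcome $m$ is $p_m(\Lambda)=\operatorname{tr}[(I_{anc}\otimes E_m)(\mathrm{id}\otimes\Lambda)(\xi\otimes\rho_{in})]=\operatorname{tr}[E_m\Lambda(\rho_{in})]$. Likewise, for $(\xi'\otimes\tau_{in},\{I_{anc}\otimes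 F_n\}_{n\in\Omega_F})$, $q_n(\Lambda)=\operatorname{tr}[F_n\Lambda(\tau_{in})]$.
   Formalization: The equivalence for the given eigenvectors assumes all four maximum eigenvalues are simple (it fails e.g. for ρ_in = I/2); in general C<T iff the overlaps differ for every choice of unit maximal eigenvectors. Ancillas are finite-dimensional; outcome sets and mixtures are finite. *)

theory Defs
  imports "HOL-Analysis.Analysis"
begin

text \<open>Operators on a finite-dimensional Hilbert space are complex square matrices
  \<^typ>\<open>complex^'n^'n\<close>, where \<open>A $ i $ j\<close> is the entry in row \<open>i\<close> and column \<open>j\<close>;
  vectors are elements of \<^typ>\<open>complex^'n\<close>, whose library norm is the Hilbert space norm.\<close>

definition cinner :: "complex^'n \<Rightarrow> complex^'n \<Rightarrow> complex" where
  "cinner v w = (\<Sum>i\<in>UNIV. cnj (v $ i) * w $ i)"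

definition adj :: "complex^'n^'n \<Rightarrow> complex^'n^'n" where
  "adj A = (\<chi> i j. cnj (A $ j $ i))"

definition unitary :: "complex^'n^'n \<Rightarrow> bool" where
  "unitary U \<longleftrightarrow> adj U ** U = mat 1 \<and> U ** adj U = mat 1"

text \<open>The set \<open>\<real>\<^sub>\<ge>\<^sub>0\<close> contains the complex numbers that are real and nonnegative,
  so this includes that the operator is Hermitian.\<close>

definition psd :: "complex^'n^'n \<Rightarrow> bool" where
  "psd A \<longleftrightarrow> (\<forall>v. cinner v (A *v v) \<in> \<real>\<^sub>\<ge>\<^sub>0)"

definition density_operator :: "complex^'n^'n \<Rightarrow> bool" where
  "density_operator \<rho> \<longleftrightarrow> psd \<rho> \<and> trace \<rho> = 1"

definition povm :: "'m set \<Rightarrow> ('m \<Rightarrow> complex^'n^'n) \<Rightarrow> bool" where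
  "povm \<Omega> E \<longleftrightarrow> finite \<Omega> \<and> (\<forall>m\<in>\<Omega>. psd (E m) \<and> psd (mat 1 - E m)) \<and> (\<Sum>m\<in>\<Omega>. E m) = mat 1"

definition random_unitary_channel :: "(complex^'n^'n \<Rightarrow> complex^'n^'n) \<Rightarrow> bool" where
  "random_unitary_channel \<Lambda> \<longleftrightarrow>
     (\<exists>(k::nat) (p :: nat \<Rightarrow> real) U.
        (\<forall>x<k. 0 \<le> p x) \<and> (\<Sum>x<k. p x) = 1 \<and> (\<forall>x<k. unitary (U x)) \<and>
        \<Lambda> = (\<lambda>X. \<Sum>x<k. p x *\<^sub>R (U x ** X ** adj (U x))))"

type_synonym ('a, 'n) joint_op = "complex^('a::finite \<times> 'n::finite)^('a \<times> 'n)"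

definition kron :: "complex^'a^'a \<Rightarrow> complex^'n^'n \<Rightarrow> ('a::finite, 'n::finite) joint_op" where
  "kron A B = (\<chi> i j. A $ fst i $ fst j * B $ snd i $ snd j)"

text \<open>The map \<open>id \<otimes> \<Lambda>\<close> for linear \<open>\<Lambda>\<close>: it applies \<open>\<Lambda>\<close> to each block
  \<open>\<langle>a| X |b\<rangle>\<close> of \<open>X\<close>, with \<open>a\<close>, \<open>b\<close> ranging over the ancilla basis.\<close>

definition id_tensor ::
    "(complex^'n^'n \<Rightarrow> complex^'n^'n) \<Rightarrow> ('a::finite, 'n::finite) joint_op \<Rightarrow> ('a, 'n) joint_op" where
  "id_tensor \<Lambda> X = (\<chi> i j. \<Lambda> (\<chi> k l. X $ (fst i, k) $ (fst j, l)) $ snd i $ snd j)"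

definition ancilla_free_measurement ::
    "complex^'a^'a \<Rightarrow> complex^'n^'n \<Rightarrow> 'm set \<Rightarrow> ('m \<Rightarrow> complex^'n^'n) \<Rightarrow> bool" where
  "ancilla_free_measurement \<xi> \<rho> \<Omega> E \<longleftrightarrow>
     density_operator \<xi> \<and> density_operator \<rho> \<and> povm \<Omega> E"

text \<open>The trace is a real number whenever \<open>\<xi>\<close>, \<open>\<rho>\<close>, \<open>E\<close> form a measurement and \<open>\<Lambda>\<close> is a
  random unitary channel; \<^const>\<open>Re\<close> only changes the type.\<close>

definition outcome_prob ::
    "complex^'a^'a \<Rightarrow> complex^'n^'n \<Rightarrow> ('m \<Rightarrow> complex^'n^'n) \<Rightarrow>
     (complex^'n^'n \<Rightarrow> complex^'n^'n) \<Rightarrow> 'm \<Rightarrow> real" where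
  "outcome_prob \<xi> \<rho> E \<Lambda> m =
     Re (trace (kron (mat 1 :: complex^'a^'a) (E m) ** id_tensor \<Lambda> (kron \<xi> \<rho>)))"

text \<open>\<^const>\<open>Greatest\<close> denotes a genuine maximum and is unspecified if none exists, so
  this is not merely the supremum.\<close>

definition max_over_channels :: "((complex^'n^'n \<Rightarrow> complex^'n^'n) \<Rightarrow> real) \<Rightarrow> real" where
  "max_over_channels f = (GREATEST v. \<exists>\<Lambda>. random_unitary_channel \<Lambda> \<and> v = f \<Lambda>)"

definition C_bound ::
    "real \<Rightarrow> complex^'a^'a \<Rightarrow> complex^'n^'n \<Rightarrow> ('m \<Rightarrow> complex^'n^'n) \<Rightarrow> 'm set \<Rightarrow>
     complex^'b^'b \<Rightarrow> complex^'n^'n \<Rightarrow> ('l \<Rightarrow> complex^'n^'n) \<Rightarrow> 'l set \<Rightarrow> real" where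
  "C_bound r \<xi> \<rho> E M \<xi>' \<tau> F N =
     max_over_channels (\<lambda>\<Lambda>. r * (\<Sum>m\<in>M. outcome_prob \<xi> \<rho> E \<Lambda> m) +
                            (1 - r) * (\<Sum>n\<in>N. outcome_prob \<xi>' \<tau> F \<Lambda> n))"

definition T_bound ::
    "real \<Rightarrow> complex^'a^'a \<Rightarrow> complex^'n^'n \<Rightarrow> ('m \<Rightarrow> complex^'n^'n) \<Rightarrow> 'm set \<Rightarrow>
     complex^'b^'b \<Rightarrow> complex^'n^'n \<Rightarrow> ('l \<Rightarrow> complex^'n^'n) \<Rightarrow> 'l set \<Rightarrow> real" where
  "T_bound r \<xi> \<rho> E M \<xi>' \<tau> F N =
     r * max_over_channels (\<lambda>\<Lambda>. \<Sum>m\<in>M. outcome_prob \<xi> \<rho> E \<Lambda> m) +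
     (1 - r) * max_over_channels (\<lambda>\<Lambda>. \<Sum>n\<in>N. outcome_prob \<xi>' \<tau> F \<Lambda> n)"

text \<open>Real eigenvalues suffice: the operators concerned are Hermitian.\<close>

definition eigenvalue :: "complex^'n^'n \<Rightarrow> real \<Rightarrow> bool" where
  "eigenvalue A c \<longleftrightarrow> (\<exists>v. v \<noteq> 0 \<and> A *v v = complex_of_real c *s v)"

definition max_eigenvector :: "complex^'n^'n \<Rightarrow> complex^'n \<Rightarrow> bool" where
  "max_eigenvector A v \<longleftrightarrow> norm v = 1 \<and>
     (\<exists>c. A *v v = complex_of_real c *s v \<and> (\<forall>d. eigenvalue A d \<longrightarrow> d \<le> c))"

text \<open>The eigenspace of the maximum eigenvalue is one-dimensional, so that its unit vector is
  determined up to a phase.\<close>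

definition nondegenerate_max :: "complex^'n^'n \<Rightarrow> bool" where
  "nondegenerate_max A \<longleftrightarrow>
     (\<forall>v w. max_eigenvector A v \<and> max_eigenvector A w \<longrightarrow> (\<exists>c. w = c *s v))"

end

theory Submission
  imports Defs
begin

text \<open>The score of a random unitary channel is a convex combination of the scores of its unitaries,
  and the unitary group is compact, so every maximum is attained at a single unitary. In dimension 2
  a Hermitian operator is \<open>c I + d |v\<rangle>\<langle>v|\<close> with \<open>d \<ge> 0\<close> for any unit maximal eigenvector \<open>v\<close>, so
  \<open>tr (A U \<rho> U\<^sup>\<dagger>)\<close> depends on \<open>U\<close> only through \<open>|\<langle>v|U u\<rangle>|\<^sup>2\<close> and is maximal iff \<open>U\<close> maps some maximal
  eigenvector of \<open>\<rho>\<close> to one of \<open>A\<close>, up to a phase. Hence the bounds coincide iff one unitary does so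
  for both measurements, and a unitary carrying a pair of unit vectors of \<open>\<complex>\<^sup>2\<close> to another pair, up to
  phases, exists iff the overlaps have the same modulus.\<close>

section \<open>Outcome probabilities of random unitary channels\<close>

text \<open>Every ancilla block of \<open>kron \<xi> \<rho>\<close> is a scalar multiple of
  \<open>\<rho>\<close>, so homogeneity of \<open>\<Lambda>\<close> already gives
  \<open>kron \<xi> (\<Lambda> \<rho>)\<close>. Products and traces factor over \<open>kron\<close>,
  so the ancilla contributes only \<open>trace \<xi>\<close>.\<close>

lemma trace_kron_id_tensor:
  fixes \<xi> :: "complex^'a^'a" and \<rho> B :: "complex^'n^'n"
  assumes lin: "\<And>c X. \<Lambda> (\<chi> i j. c * X $ i $ j) = (\<chi> i j. c * \<Lambda> X $ i $ j)"
  shows "trace (kron (mat 1 :: complex^'a^'a) B ** id_tensor \<Lambda> (kron \<xi> \<rho>)) = trace \<xi> * trace (B ** \<Lambda> \<rho>)"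
proof -
  have "id_tensor \<Lambda> (kron \<xi> \<rho>) = kron \<xi> (\<Lambda> \<rho>)"
    unfolding id_tensor_def kron_def by (simp add: vec_eq_iff lin)
  moreover have "kron A B ** kron C D = kron (A ** C) (B ** D)"
    for A C :: "complex^'a^'a" and B D :: "complex^'n^'n"
    by (simp add: kron_def matrix_matrix_mult_def vec_eq_iff sum.cartesian_product' sum_product mult_ac
        flip: UNIV_Times_UNIV)
  moreover have "trace (kron \<xi> X) = trace \<xi> * trace X" for X :: "complex^'n^'n"
    by (simp add: kron_def trace_def sum.cartesian_product' sum_product
        flip: UNIV_Times_UNIV)
  ultimately show ?thesis by simp
qed

lemma trace_sum: "trace (\<Sum>m\<in>M. E m) = (\<Sum>m\<in>M. trace (E m))" for E :: "'m \<Rightarrow> complex^'n^'n"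
  unfolding trace_def by (simp add: sum.swap[of _ M])

lemma trace_scaleR: "trace (c *\<^sub>R A) = c *\<^sub>R trace A" for A :: "complex^'n^'n"
  by (simp add: trace_def scaleR_sum_right)

lemma matrix_mult_sum_left: "(\<Sum>m\<in>M. E m) ** X = (\<Sum>m\<in>M. E m ** X)" for E :: "'m \<Rightarrow> complex^'n^'n"
  by (induction M rule: infinite_finite_induct) (auto simp: matrix_matrix_mult_def vec_eq_iff distrib_right sum.distrib)

lemma matrix_mult_sum_right: "X ** (\<Sum>m\<in>M. E m) = (\<Sum>m\<in>M. X ** E m)" for E :: "'m \<Rightarrow> complex^'n^'n"
  by (induction M rule: infinite_finite_induct) (auto simp: matrix_add_ldistrib)

lemma matrix_mult_scaleR_right: "A ** (c *\<^sub>R B) = c *\<^sub>R (A ** B)" for A B :: "complex^'n^'n"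
  by (simp add: matrix_matrix_mult_def vec_eq_iff scaleR_sum_right)

text \<open>For \<open>A\<close> a sum of POVM elements and \<open>\<rho>\<close> the input state,
  this is the total probability of those outcomes under conjugation by the single unitary
  \<open>U\<close>.\<close>

definition success :: "complex^'n^'n \<Rightarrow> complex^'n^'n \<Rightarrow> complex^'n^'n \<Rightarrow> real" where
  "success A \<rho> U = Re (trace (A ** (U ** \<rho> ** adj U)))"

text \<open>Linearity of the trace in effects and channel. The explicit form of the channel, with
  arbitrary real weights, matches the assumption \<open>f\<close> of
  \<open>max_over_channels_attained\<close>.\<close>

lemma sum_outcome_prob:
  fixes \<xi> :: "complex^'a^'a" and \<rho> :: "complex^'n^'n" and U :: "nat \<Rightarrow> complex^'n^'n"
  assumes "trace \<xi> = 1"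
  shows "(\<Sum>m\<in>M. outcome_prob \<xi> \<rho> E (\<lambda>X. \<Sum>x<k. p x *\<^sub>R (U x ** X ** adj (U x))) m)
    = (\<Sum>x<k. p x * success (\<Sum>m\<in>M. E m) \<rho> (U x))"
proof -
  let ?\<Lambda> = "\<lambda>X. \<Sum>x<k. p x *\<^sub>R (U x ** X ** adj (U x))"
  have "?\<Lambda> (\<chi> i j. c * X $ i $ j) = (\<chi> i j. c * ?\<Lambda> X $ i $ j)" for c X
    by (simp add: vec_eq_iff matrix_matrix_mult_def sum_distrib_left sum_distrib_right mult_ac)
  then have "outcome_prob \<xi> \<rho> E ?\<Lambda> m = Re (trace (E m ** ?\<Lambda> \<rho>))" for m
    unfolding outcome_prob_def by (subst trace_kron_id_tensor) (simp_all add: assms)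
  then have "(\<Sum>m\<in>M. outcome_prob \<xi> \<rho> E ?\<Lambda> m) = Re (trace ((\<Sum>m\<in>M. E m) ** ?\<Lambda> \<rho>))"
    by (simp add: trace_sum matrix_mult_sum_left)
  also have "\<dots> = (\<Sum>x<k. p x * success (\<Sum>m\<in>M. E m) \<rho> (U x))"
    by (simp add: success_def matrix_mult_sum_right trace_sum trace_scaleR
        matrix_mult_scaleR_right)
  finally show ?thesis .
qed

section \<open>Compactness of the unitary group and maxima over channels\<close>

text \<open>Rows of a unitary are unit vectors, which bounds the entries by 1; closedness holds
  because two continuous equations define the set.\<close>

lemma compact_unitary: "compact (Collect unitary :: (complex^'n^'n) set)"
  unfolding compact_eq_bounded_closed
proof
  have "cmod (U $ i $ j) \<le> 1" if "unitary U" for U :: "complex^'n^'n" and i j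
  proof -
    have "(U ** adj U) $ i $ i = 1" using that by (simp add: unitary_def mat_def)
    then have "complex_of_real (\<Sum>k\<in>UNIV. (cmod (U $ i $ k))\<^sup>2) = 1"
      by (simp add: matrix_matrix_mult_def adj_def complex_norm_square del: of_real_power)
    then have "(\<Sum>k\<in>UNIV. (cmod (U $ i $ k))\<^sup>2) = 1" using of_real_eq_1_iff by blast
    moreover have "(cmod (U $ i $ j))\<^sup>2 \<le> (\<Sum>k\<in>UNIV. (cmod (U $ i $ k))\<^sup>2)"
      by (rule member_le_sum) auto
    ultimately show ?thesis by (simp add: abs_square_le_1)
  qed
  then have entries: "(\<Sum>i\<in>UNIV. \<Sum>j\<in>UNIV. cmod (U $ i $ j)) \<le> (\<Sum>i\<in>(UNIV :: 'n set). \<Sum>j\<in>(UNIV :: 'n set). 1)"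
    if "unitary U" for U :: "complex^'n^'n"
    using that by (intro sum_mono) auto
  have "norm U \<le> (\<Sum>i\<in>UNIV. \<Sum>j\<in>UNIV. cmod (U $ i $ j))" for U :: "complex^'n^'n"
    unfolding norm_vec_def
    by (intro order_trans[OF L2_set_le_sum] sum_mono L2_set_le_sum) auto
  from order_trans[OF this entries]
  show "bounded (Collect unitary :: (complex^'n^'n) set)"
    unfolding bounded_iff by blast
next
  have "Collect unitary = {U :: complex^'n^'n. adj U ** U = mat 1} \<inter> {U. U ** adj U = mat 1}"
    by (auto simp: unitary_def)
  moreover have "closed {U :: complex^'n^'n. adj U ** U = mat 1}"
    "closed {U :: complex^'n^'n. U ** adj U = mat 1}"
    unfolding adj_def matrix_matrix_mult_def by (intro closed_Collect_eq continuous_intros)+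
  ultimately show "closed (Collect unitary :: (complex^'n^'n) set)" by (simp add: closed_Int)
qed

lemma continuous_on_success: "continuous_on S (success A \<rho>)"
  unfolding success_def trace_def adj_def matrix_matrix_mult_def
  by (intro continuous_intros)

lemma unitary_mat_1: "unitary (mat 1)"
proof -
  have "adj (mat 1) = (mat 1 :: complex^'n^'n)" by (auto simp: adj_def mat_def vec_eq_iff)
  then show ?thesis by (simp add: unitary_def)
qed

text \<open>A mixture scores an average of \<open>g\<close>, which cannot exceed the largest value
  of \<open>g\<close> on unitaries. Compactness supplies that value and a one-term mixture attains
  it, so \<open>Greatest\<close> is well specified.\<close>

lemma max_over_channels_attained:
  fixes g :: "complex^'n^'n \<Rightarrow> real"
  assumes f: "\<And>k p U. f (\<lambda>X. \<Sum>x<k::nat. p x *\<^sub>R (U x ** X ** adj (U x))) = (\<Sum>x<k. p x * g (U x))"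
    and g: "continuous_on (Collect unitary) g"
  obtains V where "unitary V" "\<And>U. unitary U \<Longrightarrow> g U \<le> g V" "max_over_channels f = g V"
proof -
  have "Collect unitary \<noteq> ({} :: (complex^'n^'n) set)" using unitary_mat_1 by blast
  then obtain V where V: "unitary V" "\<And>U. unitary U \<Longrightarrow> g U \<le> g V"
    using continuous_attains_sup[OF compact_unitary _ g] by auto
  have "max_over_channels f = g V"
    unfolding max_over_channels_def
  proof (rule Greatest_equality)
    have "random_unitary_channel (\<lambda>X. \<Sum>x<1::nat. 1 *\<^sub>R (V ** X ** adj V))"
      unfolding random_unitary_channel_def using V(1)
      by (intro exI[of _ "1::nat"] exI[of _ "\<lambda>_::nat. 1::real"] exI[of _ "\<lambda>_. V"]) auto
    moreover have "f (\<lambda>X. \<Sum>x<1::nat. 1 *\<^sub>R (V ** X ** adj V)) = g V"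
      using f[where k = 1 and p = "\<lambda>_. 1" and U = "\<lambda>_. V"] by simp
    ultimately show "\<exists>\<Lambda>. random_unitary_channel \<Lambda> \<and> g V = f \<Lambda>" by metis
  next
    fix v assume "\<exists>\<Lambda>. random_unitary_channel \<Lambda> \<and> v = f \<Lambda>"
    then obtain k p U where p: "\<forall>x<k. 0 \<le> p x" "(\<Sum>x<k::nat. p x) = 1"
      and U: "\<forall>x<k. unitary (U x)" and v: "v = (\<Sum>x<k. p x * g (U x))"
      unfolding random_unitary_channel_def using f by blast
    have "v \<le> (\<Sum>x<k. p x * g V)"
      unfolding v using p U V by (intro sum_mono mult_left_mono) auto
    then show "v \<le> g V" using p by (simp flip: sum_distrib_right)
  qed
  then show thesis using V that by blast
qed

section \<open>Inner products and orthonormal bases of the plane\<close>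

lemma cinner_self: "cinner v v = complex_of_real ((norm v)\<^sup>2)"
  by (simp add: cinner_def norm_vec_def L2_set_def real_sqrt_pow2 sum_nonneg complex_norm_square
      mult.commute del: of_real_power)

lemma cinner_adj: "cinner v (A *v w) = cinner (adj A *v v) w"
  unfolding cinner_def adj_def matrix_vector_mult_def
  by (simp add: sum_distrib_left sum_distrib_right mult_ac, subst sum.swap, rule refl)

lemma cinner_unitary:
  assumes "unitary U"
  shows "cinner (U *v v) (U *v w) = cinner v w"
  using assms by (simp add: cinner_adj[of "U *v v"] matrix_vector_mul_assoc unitary_def)

lemma norm_unitary:
  assumes "unitary U"
  shows "norm (U *v v) = norm v"
proof -
  have "complex_of_real ((norm (U *v v))\<^sup>2) = complex_of_real ((norm v)\<^sup>2)"
    using cinner_unitary[OF assms, of v v] by (simp add: cinner_self)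
  then have "(norm (U *v v))\<^sup>2 = (norm v)\<^sup>2" using of_real_eq_iff by blast
  then show ?thesis by simp
qed

lemma cinner_scale_left: "cinner (c *s v) w = cnj c * cinner v w"
  by (simp add: cinner_def sum_distrib_left mult_ac)

lemma cinner_scale_right: "cinner v (c *s w) = c * cinner v w"
  by (simp add: cinner_def sum_distrib_left mult_ac)

lemma cinner_commute: "cinner w v = cnj (cinner v w)"
  by (simp add: cinner_def mult.commute)

lemma norm_scale: "norm (c *s v) = cmod c * norm v" for v :: "complex^'n"
  by (simp add: norm_vec_def norm_mult L2_set_right_distrib)

lemma cinner_add_right: "cinner v (w + x) = cinner v w + cinner v x"
  by (simp add: cinner_def distrib_left sum.distrib)

lemma cinner_2: "cinner v w = cnj (v $ 1) * w $ 1 + cnj (v $ 2) * w $ 2" for v w :: "complex^2"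
  by (simp add: cinner_def sum_2)

definition outer :: "complex^'n \<Rightarrow> complex^'n \<Rightarrow> complex^'n^'n" where
  "outer v w = (\<chi> i j. v $ i * cnj (w $ j))"

lemma outer_mult_vec: "outer v w *v x = cinner w x *s v"
  by (simp add: outer_def cinner_def matrix_vector_mult_def vec_eq_iff sum_distrib_left mult_ac)

text \<open>An explicit antiunitary map: for unit \<open>v\<close> it completes \<open>v\<close> to
  an orthonormal basis without a choice of second vector.\<close>

definition perp :: "complex^2 \<Rightarrow> complex^2" where
  "perp v = vector [- cnj (v $ 2), cnj (v $ 1)]"

lemma perp_components [simp]: "perp v $ 1 = - cnj (v $ 2)" "perp v $ 2 = cnj (v $ 1)"
  by (simp_all add: perp_def)

lemma cinner_perp [simp]: "cinner v (perp v) = 0" "cinner (perp v) v = 0"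
  "cinner (perp v) (perp w) = cinner w v"
  by (simp_all add: cinner_2)

lemma norm_perp [simp]: "norm (perp v) = norm v"
  by (simp add: norm_vec_def L2_set_def sum_2 add.commute)

text \<open>Resolution of the identity for the basis \<open>v\<close>, \<open>perp v\<close>: the
  off-diagonal entries cancel and both diagonal entries are the squared norm of
  \<open>v\<close>.\<close>

lemma outer_add_perp:
  assumes "norm v = 1"
  shows "outer v v + outer (perp v) (perp v) = mat 1"
proof -
  have "v $ 1 * cnj (v $ 1) + v $ 2 * cnj (v $ 2) = 1"
    using cinner_self[of v] assms by (simp add: cinner_2 mult.commute)
  then show ?thesis
    by (simp add: vec_eq_iff forall_2 outer_def mat_def mult.commute add.commute)
qed

lemma expansion_perp:
  assumes "norm v = 1"
  shows "w = cinner v w *s v + cinner (perp v) w *s perp v"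
  using arg_cong[OF outer_add_perp[OF assms], of "\<lambda>A. A *v w"]
  by (simp add: matrix_vector_mult_add_rdistrib outer_mult_vec)

text \<open>Since \<open>cinner (perp v) w\<close> is the determinant of the pair \<open>v\<close>,
  \<open>w\<close>, this is Lagrange's identity. It yields Cauchy-Schwarz together with the equality
  case below.\<close>

lemma cmod_cinner_perp:
  "(cmod (cinner v w))\<^sup>2 + (cmod (cinner (perp v) w))\<^sup>2 = (norm v)\<^sup>2 * (norm w)\<^sup>2"
proof -
  have "complex_of_real ((cmod (cinner v w))\<^sup>2 + (cmod (cinner (perp v) w))\<^sup>2)
      = complex_of_real ((norm v)\<^sup>2 * (norm w)\<^sup>2)"
    by (simp only: of_real_add of_real_mult complex_norm_square flip: cinner_self)
       (simp add: cinner_2 algebra_simps)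
  then show ?thesis using of_real_eq_iff by blast
qed

lemma cmod_cinner_squared_le_1:
  fixes v w :: "complex^2"
  assumes "norm v = 1" "norm w = 1"
  shows "(cmod (cinner v w))\<^sup>2 \<le> 1"
proof -
  have "(cmod (cinner v w))\<^sup>2 + (cmod (cinner (perp v) w))\<^sup>2 = 1"
    using cmod_cinner_perp[of v w] assms by simp
  then show ?thesis by (smt (verit) zero_le_power2)
qed

lemma cmod_cinner_eq_1:
  fixes v w :: "complex^2"
  assumes "norm v = 1" "norm w = 1" "cmod (cinner v w) = 1"
  shows "w = cinner v w *s v"
  using cmod_cinner_perp[of v w] expansion_perp[of v w] assms by simp

section \<open>Spectral form of Hermitian matrices in dimension 2\<close>

lemma adj_psd:
  fixes A :: "complex^2^2"
  assumes "psd A"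
  shows "adj A = A"
proof -
  have R: "Im (cinner v (A *v v)) = 0" for v
    using assms by (auto simp: psd_def complex_nonneg_Reals_iff)
  note R = R[unfolded cinner_2 matrix_vector_mult_def, simplified sum_2]
  show ?thesis
    \<comment> \<open>The basis vectors make the diagonal real; \<open>(1, 1)\<close> and
      \<open>(1, i)\<close> then compare the imaginary and the real parts of the off-diagonal
      entries.\<close>
    using R[of "vector [1, 0]"] R[of "vector [0, 1]"] R[of "vector [1, 1]"] R[of "vector [1, \<i>]"]
    by (simp add: adj_def vec_eq_iff forall_2 complex_eq_iff sum_2)
qed


text \<open>Entrywise spectral decomposition, where \<open>xc\<close>, \<open>yc\<close>, \<open>q\<close> stand for the conjugates of \<open>x\<close>, \<open>y\<close>, \<open>p\<close>,
  so that \<open>algebra\<close> applies.\<close>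

lemma eigen_entries:
  fixes a b p q x y xc yc c :: complex
  assumes "a * x + p * y = c * x" "q * x + b * y = c * y"
    and "a * xc + q * yc = c * xc" "p * xc + b * yc = c * yc"
    and "x * xc + y * yc = 1"
  shows "a = a + b - c + (2 * c - a - b) * (x * xc)"
    "p = (2 * c - a - b) * (x * yc)"
    "q = (2 * c - a - b) * (y * xc)"
    "b = a + b - c + (2 * c - a - b) * (y * yc)"
  using assms by algebra+

text \<open>The second eigenvalue is the trace minus the first, with eigenvector
  \<open>perp v\<close>, and \<open>d\<close> is the gap between them, nonnegative by maximality. A
  degenerate eigenvalue gives \<open>d = 0\<close>, so every unit maximal eigenvector is admissible
  as \<open>v\<close>.\<close>

lemma spectral_2:
  fixes A :: "complex^2^2"
  assumes A: "adj A = A" and v: "max_eigenvector A v"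
  obtains c d where "0 \<le> d" "A = c *\<^sub>R mat 1 + d *\<^sub>R outer v v"
proof -
  obtain c where c: "A *v v = complex_of_real c *s v" and max: "\<And>d. eigenvalue A d \<Longrightarrow> d \<le> c"
    and norm: "norm v = 1"
    using v unfolding max_eigenvector_def by blast
  have adj: "cnj (A $ 1 $ 1) = A $ 1 $ 1" "cnj (A $ 2 $ 2) = A $ 2 $ 2"
    "cnj (A $ 1 $ 2) = A $ 2 $ 1" "cnj (A $ 2 $ 1) = A $ 1 $ 2"
    using A by (auto simp: adj_def vec_eq_iff forall_2)
  then have re: "complex_of_real (Re (A $ 1 $ 1)) = A $ 1 $ 1" "complex_of_real (Re (A $ 2 $ 2)) = A $ 2 $ 2"
    by (simp_all add: complex_eq_iff)
  have ev: "A $ 1 $ 1 * v $ 1 + A $ 1 $ 2 * v $ 2 = c * v $ 1"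
    "A $ 2 $ 1 * v $ 1 + A $ 2 $ 2 * v $ 2 = c * v $ 2"
    using c by (auto simp: vec_eq_iff forall_2 matrix_vector_mult_def sum_2)
  \<comment> \<open>Conjugating the eigenvalue equation, with \<open>A\<close> Hermitian and
    \<open>c\<close> real, gives the equations for the conjugate entries in
    \<open>eigen_entries\<close>.\<close>
  have ev': "A $ 1 $ 1 * cnj (v $ 1) + A $ 2 $ 1 * cnj (v $ 2) = c * cnj (v $ 1)"
    "A $ 1 $ 2 * cnj (v $ 1) + A $ 2 $ 2 * cnj (v $ 2) = c * cnj (v $ 2)"
    using ev[THEN arg_cong[where f = cnj]] by (simp_all add: adj)
  have "v $ 1 * cnj (v $ 1) + v $ 2 * cnj (v $ 2) = 1"
    using cinner_self[of v] norm by (simp add: cinner_2 mult.commute)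
  note entries = eigen_entries[OF ev ev' this]
  define e where "e = Re (A $ 1 $ 1) + Re (A $ 2 $ 2) - c"
  have e: "complex_of_real e = A $ 1 $ 1 + A $ 2 $ 2 - c"
    "2 * complex_of_real c - A $ 1 $ 1 - A $ 2 $ 2 = complex_of_real c - complex_of_real e"
    by (simp_all add: e_def re)
  have "A $ i $ j = (if i = j then complex_of_real e else 0) + complex_of_real (c - e) * (v $ i * cnj (v $ j))"
    for i j
    using entries[folded e(1), unfolded e(2)] exhaust_2[of i] exhaust_2[of j] by auto
  then have decomp: "A = e *\<^sub>R mat 1 + (c - e) *\<^sub>R outer v v"
    by (simp add: vec_eq_iff outer_def mat_def) (simp add: scaleR_conv_of_real)
  have "(s *\<^sub>R B) *v w = complex_of_real s *s (B *v w)" for s and B :: "complex^2^2" and w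
    by (simp add: matrix_vector_mult_def vec_eq_iff sum_2) (simp add: scaleR_conv_of_real algebra_simps)
  then have "A *v perp v = e *s perp v"
    by (subst decomp) (simp add: matrix_vector_mult_add_rdistrib outer_mult_vec)
  then have "eigenvalue A e"
    unfolding eigenvalue_def by (metis norm norm_perp norm_zero zero_neq_one)
  then have "0 \<le> c - e" using max by simp
  then show thesis using that decomp by blast
qed

section \<open>Success probability in spectral form\<close>

lemma matrix_mult_scaleR_left: "(c *\<^sub>R A) ** B = c *\<^sub>R (A ** B)" for A B :: "complex^'n^'n"
  by (simp add: matrix_matrix_mult_def vec_eq_iff scaleR_sum_right)

lemma matrix_mult_add_left: "(A + B) ** C = A ** C + B ** C" for A B C :: "complex^'n^'n"
  by (simp add: matrix_matrix_mult_def vec_eq_iff distrib_right sum.distrib)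

lemma matrix_mult_add_right: "C ** (A + B) = C ** A + C ** B" for A B C :: "complex^'n^'n"
  by (simp add: matrix_matrix_mult_def vec_eq_iff distrib_left sum.distrib)

lemma matrix_mult_outer: "A ** outer v w = outer (A *v v) w"
  by (simp add: outer_def matrix_matrix_mult_def matrix_vector_mult_def vec_eq_iff sum_distrib_right mult.assoc)

lemma outer_mult_adj: "outer v w ** adj A = outer v (A *v w)"
  by (simp add: outer_def adj_def matrix_matrix_mult_def matrix_vector_mult_def vec_eq_iff sum_distrib_left mult_ac)

lemma adj_outer: "adj (outer v w) = outer w v"
  by (simp add: adj_def outer_def vec_eq_iff mult.commute)

lemma adj_add: "adj (A + B) = adj A + adj B"
  by (simp add: adj_def vec_eq_iff)

lemma trace_outer: "trace (outer v w) = cinner w v"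
  by (simp add: trace_def outer_def cinner_def mult.commute)

text \<open>Conjugation by \<open>U\<close> turns the projector onto \<open>u\<close> into that onto
  \<open>U *v u\<close>, and the trace of a product of two such projectors is a squared overlap. The
  factor 2 is the trace of the identity; only the last term depends on \<open>U\<close>.\<close>

lemma success_spectral:
  fixes u v :: "complex^2"
  assumes U: "unitary U" and u: "norm u = 1" and v: "norm v = 1"
  shows "success (c *\<^sub>R mat 1 + d *\<^sub>R outer v v) (a *\<^sub>R mat 1 + b *\<^sub>R outer u u) U
    = 2 * a * c + b * c + a * d + b * d * (cmod (cinner v (U *v u)))\<^sup>2"
proof -
  let ?w = "U *v u"
  have w: "cinner ?w ?w = 1" using norm_unitary[OF U, of u] u by (simp add: cinner_self)
  have v: "cinner v v = 1" using v by (simp add: cinner_self)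
  have "U ** (a *\<^sub>R mat 1 + b *\<^sub>R outer u u) ** adj U = a *\<^sub>R mat 1 + b *\<^sub>R outer ?w ?w"
    using U by (simp add: matrix_mult_add_right matrix_mult_add_left matrix_mult_scaleR_left matrix_mult_scaleR_right
        matrix_mult_outer outer_mult_adj unitary_def)
  moreover have "cinner v ?w * cinner ?w v = complex_of_real ((cmod (cinner v ?w))\<^sup>2)"
    by (subst cinner_commute[of ?w v]) (simp only: complex_norm_square)
  then have "trace (outer v v ** outer ?w ?w) = complex_of_real ((cmod (cinner v ?w))\<^sup>2)"
    by (simp add: matrix_mult_outer outer_mult_vec trace_outer cinner_scale_right del: of_real_power)
  ultimately show ?thesis
    by (simp add: success_def matrix_mult_add_right matrix_mult_add_left matrix_mult_scaleR_left matrix_mult_scaleR_right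
        trace_add trace_scaleR trace_outer trace_I v w algebra_simps del: of_real_power)
qed


section \<open>Unitaries carrying one pair of vectors to another\<close>

text \<open>The phase \<open>sgn x * cnj (sgn y)\<close> rotates \<open>y\<close> into the direction
  of \<open>x\<close>, giving equality in the triangle inequality. As \<open>sgn 0 = 0\<close> is
  not a phase, vanishing arguments are treated separately.\<close>

lemma exists_phase_aligned: "\<exists>z. cmod z = 1 \<and> cmod (x + z * y) = cmod x + cmod y"
proof (cases "x = 0 \<or> y = 0")
  case True
  then show ?thesis by (intro exI[of _ 1]) auto
next
  case False
  moreover have "y * cnj y = complex_of_real (cmod y) * complex_of_real (cmod y)"
    using complex_norm_square[of y] by (simp add: power2_eq_square)
  ultimately have "x + (sgn x * cnj (sgn y)) * y = sgn x * complex_of_real (cmod x + cmod y)"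
    by (simp add: sgn_div_norm scaleR_conv_of_real field_simps)
  then have "cmod (x + (sgn x * cnj (sgn y)) * y) = cmod x + cmod y"
    using False by (simp add: norm_mult norm_sgn del: of_real_add)
  then show ?thesis
    using False by (intro exI[of _ "sgn x * cnj (sgn y)"]) (auto simp: norm_mult norm_sgn)
qed

text \<open>Sending \<open>\<alpha>\<close> to \<open>\<alpha>'\<close> leaves one free phase, on
  the orthogonal direction. Equal overlaps make the orthogonal components of \<open>\<beta>\<close>
  and \<open>\<beta>'\<close> equal in modulus as well, so this phase can align
  \<open>\<beta>\<close> too.\<close>

lemma exists_unitary_aligning:
  fixes \<alpha> \<beta> \<alpha>' \<beta>' :: "complex^2"
  assumes unit: "norm \<alpha> = 1" "norm \<beta> = 1" "norm \<alpha>' = 1" "norm \<beta>' = 1"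
    and overlap: "cmod (cinner \<alpha> \<beta>) = cmod (cinner \<alpha>' \<beta>')"
  obtains U where "unitary U" "cmod (cinner \<alpha>' (U *v \<alpha>)) = 1" "cmod (cinner \<beta>' (U *v \<beta>)) = 1"
proof -
  obtain z where z: "cmod z = 1" and aligned:
    "cmod (cinner \<alpha> \<beta> * cinner \<beta>' \<alpha>' + z * (cinner (perp \<alpha>) \<beta> * cinner \<beta>' (perp \<alpha>')))
      = cmod (cinner \<alpha> \<beta> * cinner \<beta>' \<alpha>') + cmod (cinner (perp \<alpha>) \<beta> * cinner \<beta>' (perp \<alpha>'))"
    using exists_phase_aligned by blast
  \<comment> \<open>This maps the basis \<open>\<alpha>\<close>, \<open>perp \<alpha>\<close> to
    \<open>\<alpha>'\<close>, \<open>z *s perp \<alpha>'\<close>; the phase \<open>z\<close> was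
    chosen to add up the two contributions to \<open>cinner \<beta>' (U *v \<beta>)\<close>.\<close>
  define U where "U = outer \<alpha>' \<alpha> + outer (z *s perp \<alpha>') (perp \<alpha>)"
  have Uv: "U *v v = cinner \<alpha> v *s \<alpha>' + (z * cinner (perp \<alpha>) v) *s perp \<alpha>'" for v
    by (simp add: U_def matrix_vector_mult_add_rdistrib outer_mult_vec mult.commute)
  have adjv: "adj U *v v = cinner \<alpha>' v *s \<alpha> + (cnj z * cinner (perp \<alpha>') v) *s perp \<alpha>" for v
    by (simp add: U_def adj_add adj_outer matrix_vector_mult_add_rdistrib outer_mult_vec cinner_scale_left)
  have zz: "cnj z * z = 1" using z complex_norm_square[of z] by (simp add: mult.commute)
  have self: "cinner \<alpha> \<alpha> = 1" "cinner \<alpha>' \<alpha>' = 1" using unit by (simp_all add: cinner_self)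
  have "adj U ** U = outer \<alpha> \<alpha> + outer (perp \<alpha>) (perp \<alpha>)"
    by (subst (2) U_def) (simp add: matrix_mult_add_right matrix_mult_outer vector_scalar_commute adjv self zz mult.commute[of z])
  then have "adj U ** U = mat 1" using outer_add_perp unit(1) by simp
  then have "unitary U" by (simp add: unitary_def matrix_left_right_inverse)
  moreover have "cmod (cinner \<alpha>' (U *v \<alpha>)) = 1"
    by (simp add: Uv self)
  moreover have "cmod (cinner \<beta>' (U *v \<beta>)) = 1"
  proof -
    have sq: "(cmod (cinner \<alpha> \<beta>))\<^sup>2 + (cmod (cinner (perp \<alpha>) \<beta>))\<^sup>2 = 1"
      "(cmod (cinner \<alpha>' \<beta>'))\<^sup>2 + (cmod (cinner (perp \<alpha>') \<beta>'))\<^sup>2 = 1"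
      using cmod_cinner_perp[of \<alpha> \<beta>] cmod_cinner_perp[of \<alpha>' \<beta>'] unit by simp_all
    then have "(cmod (cinner (perp \<alpha>) \<beta>))\<^sup>2 = (cmod (cinner (perp \<alpha>') \<beta>'))\<^sup>2"
      unfolding overlap by linarith
    then have perp: "cmod (cinner (perp \<alpha>) \<beta>) = cmod (cinner (perp \<alpha>') \<beta>')" by simp
    have comm: "cmod (cinner \<beta>' v) = cmod (cinner v \<beta>')" for v
      by (subst cinner_commute) simp
    have "cinner \<beta>' (U *v \<beta>)
        = cinner \<alpha> \<beta> * cinner \<beta>' \<alpha>' + z * (cinner (perp \<alpha>) \<beta> * cinner \<beta>' (perp \<alpha>'))"
      by (simp add: Uv cinner_add_right cinner_scale_right mult_ac)
    \<comment> \<open>The moduli agree in pairs, so the aligned sum becomes the sum of squares in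
      \<open>sq\<close>, which is 1.\<close>
    then show ?thesis
      using aligned sq overlap perp by (simp add: norm_mult comm power2_eq_square)
  qed
  ultimately show thesis using that by blast
qed

text \<open>Unit vectors with overlap of modulus 1 agree up to a phase, and a unitary preserves
  inner products.\<close>

lemma cmod_cinner_eq_of_aligned:
  fixes \<alpha> \<beta> \<alpha>' \<beta>' :: "complex^2"
  assumes unit: "norm \<alpha> = 1" "norm \<beta> = 1" "norm \<alpha>' = 1" "norm \<beta>' = 1" and U: "unitary U"
    and a: "cmod (cinner \<alpha>' (U *v \<alpha>)) = 1" and b: "cmod (cinner \<beta>' (U *v \<beta>)) = 1"
  shows "cmod (cinner \<alpha> \<beta>) = cmod (cinner \<alpha>' \<beta>')"
proof -
  have "U *v \<alpha> = cinner \<alpha>' (U *v \<alpha>) *s \<alpha>'" "U *v \<beta> = cinner \<beta>' (U *v \<beta>) *s \<beta>'"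
    using cmod_cinner_eq_1[OF unit(3) _ a] cmod_cinner_eq_1[OF unit(4) _ b] unit U
    by (simp_all add: norm_unitary)
  then have "cinner (U *v \<alpha>) (U *v \<beta>)
      = cnj (cinner \<alpha>' (U *v \<alpha>)) * (cinner \<beta>' (U *v \<beta>) * cinner \<alpha>' \<beta>')"
    by (metis cinner_scale_left cinner_scale_right)
  then show ?thesis using U a b by (simp add: cinner_unitary norm_mult)
qed

section \<open>Optimal unitaries and aligned maximal eigenvectors\<close>

text \<open>Gives the free choice of eigenvector in the degenerate cases of
  \<open>success_max_aligned\<close>.\<close>

lemma max_eigenvector_scaleR_mat_1:
  assumes "norm v = 1"
  shows "max_eigenvector (c *\<^sub>R mat 1) v"
proof -
  have *: "(c *\<^sub>R mat 1) *v w = complex_of_real c *s w" for w :: "complex^'a"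
    by (simp add: vec_eq_iff matrix_vector_mult_def mat_def if_distrib if_distribR cong: if_cong)
      (simp add: scaleR_conv_of_real)
  have "d = c" if "w \<noteq> 0" "complex_of_real c *s w = complex_of_real d *s w" for d and w :: "complex^'a"
    using that by (auto simp: vec_eq_iff)
  then have "d \<le> c" if "eigenvalue (c *\<^sub>R mat 1 :: complex^'a^'a) d" for d
    using that unfolding eigenvalue_def * by blast
  then show ?thesis
    unfolding max_eigenvector_def using assms * by blast
qed

text \<open>The overlap enters with the coefficient \<open>b * d\<close>, which is nonnegative, and
  full alignment gives the squared overlap its largest value 1.\<close>

lemma success_aligned_max:
  fixes A \<rho> :: "complex^2^2"
  assumes "adj A = A" "adj \<rho> = \<rho>" and v: "max_eigenvector A v" and u: "max_eigenvector \<rho> u"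
    and U: "unitary U" "cmod (cinner v (U *v u)) = 1" and V: "unitary V"
  shows "success A \<rho> V \<le> success A \<rho> U"
proof -
  obtain c d where d: "0 \<le> d" and A: "A = c *\<^sub>R mat 1 + d *\<^sub>R outer v v"
    using spectral_2[OF assms(1) v] .
  obtain a b where b: "0 \<le> b" and \<rho>: "\<rho> = a *\<^sub>R mat 1 + b *\<^sub>R outer u u"
    using spectral_2[OF assms(2) u] .
  have norm: "norm u = 1" "norm v = 1" using u v by (simp_all add: max_eigenvector_def)
  have "(cmod (cinner v (V *v u)))\<^sup>2 \<le> 1"
    using norm V by (intro cmod_cinner_squared_le_1) (simp_all add: norm_unitary)
  then have "b * d * (cmod (cinner v (V *v u)))\<^sup>2 \<le> b * d"
    using b d by (simp add: mult_left_le)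
  then show ?thesis
    unfolding A \<rho> using norm U V by (simp add: success_spectral)
qed

text \<open>If \<open>b * d\<close> is positive, optimality forces the given \<open>v\<close> and
  \<open>u\<close> to be aligned. Otherwise one operator is a multiple of the identity and its
  eigenvector can be replaced by one that fits \<open>U\<close>, hence the new vectors
  \<open>v'\<close> and \<open>u'\<close>.\<close>

lemma success_max_aligned:
  fixes A \<rho> :: "complex^2^2"
  assumes "adj A = A" "adj \<rho> = \<rho>" and v: "max_eigenvector A v" and u: "max_eigenvector \<rho> u"
    and U: "unitary U" and max: "\<And>V. unitary V \<Longrightarrow> success A \<rho> V \<le> success A \<rho> U"
  obtains v' u' where "max_eigenvector A v'" "max_eigenvector \<rho> u'" "cmod (cinner v' (U *v u')) = 1"
proof -
  obtain c d where d: "0 \<le> d" and A: "A = c *\<^sub>R mat 1 + d *\<^sub>R outer v v"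
    using spectral_2[OF assms(1) v] .
  obtain a b where b: "0 \<le> b" and \<rho>: "\<rho> = a *\<^sub>R mat 1 + b *\<^sub>R outer u u"
    using spectral_2[OF assms(2) u] .
  have norm: "norm u = 1" "norm v = 1" using u v by (simp_all add: max_eigenvector_def)
  \<comment> \<open>A competitor with full overlap: the pairs \<open>u\<close>, \<open>u\<close> and
    \<open>v\<close>, \<open>v\<close> trivially have equal overlaps.\<close>
  obtain V where V: "unitary V" "cmod (cinner v (V *v u)) = 1"
    using exists_unitary_aligning[of u u v v] norm by (metis cinner_self)
  have "b * d \<le> b * d * (cmod (cinner v (U *v u)))\<^sup>2"
    using max[OF V(1)] V U norm unfolding A \<rho> by (simp add: success_spectral)
  moreover have "(cmod (cinner v (U *v u)))\<^sup>2 \<le> 1"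
    using norm U by (intro cmod_cinner_squared_le_1) (simp_all add: norm_unitary)
  moreover have "0 \<le> b * d" using b d by simp
  ultimately consider "d = 0" | "b = 0" | "(cmod (cinner v (U *v u)))\<^sup>2 = 1"
    by (metis antisym mult_eq_0_iff mult_left_le mult.right_neutral mult_left_cancel)
  then show thesis
  proof cases
    case 1
    \<comment> \<open>Here \<open>A\<close> is a multiple of the identity, so the image of
      \<open>u\<close> serves as its eigenvector.\<close>
    have "norm (U *v u) = 1" using norm U by (simp add: norm_unitary)
    then show thesis
      using that[of "U *v u" u] u max_eigenvector_scaleR_mat_1[of "U *v u" c] 1
      by (simp add: A cinner_self)
  next
    case 2
    \<comment> \<open>Here \<open>\<rho>\<close> is a multiple of the identity, so \<open>v\<close>
      is pulled back along \<open>U\<close>.\<close>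
    have adj: "unitary (adj U)" using U by (simp add: unitary_def adj_def)
    have "U *v (adj U *v v) = v" using U by (simp add: matrix_vector_mul_assoc unitary_def)
    moreover have "norm (adj U *v v) = 1" using norm adj by (simp add: norm_unitary)
    ultimately show thesis
      using that[of v "adj U *v v"] v max_eigenvector_scaleR_mat_1[of "adj U *v v" a] 2 norm
      by (simp add: \<rho> cinner_self)
  next
    case 3
    then have "cmod (cinner v (U *v u)) = 1" by (simp add: power2_eq_1_iff)
       (smt (verit) norm_ge_zero)
    then show thesis using that u v by blast
  qed
qed

section \<open>Degeneracy and the criterion for a nontrivial bound\<close>

lemma adj_sum_psd:
  fixes E :: "'m \<Rightarrow> complex^2^2"
  assumes "\<And>m. m \<in> M \<Longrightarrow> psd (E m)"
  shows "adj (\<Sum>m\<in>M. E m) = (\<Sum>m\<in>M. E m)"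
proof -
  have "adj 0 = (0 :: complex^2^2)" by (simp add: adj_def vec_eq_iff)
  then have "adj (\<Sum>m\<in>M. E m) = (\<Sum>m\<in>M. adj (E m))"
    by (induction M rule: infinite_finite_induct) (simp_all add: adj_add)
  then show ?thesis using assms by (simp add: adj_psd)
qed

lemma nondegenerate_max_phase:
  assumes "nondegenerate_max A" "max_eigenvector A v" "max_eigenvector A w"
  obtains z where "cmod z = 1" "w = z *s v"
  using assms norm_scale[of _ v] unfolding nondegenerate_max_def max_eigenvector_def
  by (metis mult.right_neutral)

lemma cmod_cinner_nondegenerate:
  assumes "nondegenerate_max A" "max_eigenvector A v" "max_eigenvector A v'"
    and "nondegenerate_max B" "max_eigenvector B w" "max_eigenvector B w'"
  shows "cmod (cinner v' w') = cmod (cinner v w)"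
proof -
  obtain y z where "cmod y = 1" "v' = y *s v" "cmod z = 1" "w' = z *s w"
    using nondegenerate_max_phase assms by metis
  then show ?thesis by (simp add: cinner_scale_left cinner_scale_right norm_mult)
qed

text \<open>Overlaps of maximal eigenvectors are independent of their choice if the maximal
  eigenspaces are lines; the first conjunct is this case. With degeneracy the overlaps may depend on
  the choice, and the criterion becomes that no choice makes them equal.\<close>

theorem proposition1:
  fixes \<xi> :: "complex^'a^'a" and \<xi>' :: "complex^'b^'b"
    and \<rho> \<tau> :: "complex^2^2"
    and \<Omega>\<^sub>E M :: "'m set" and E :: "'m \<Rightarrow> complex^2^2"
    and \<Omega>\<^sub>F N :: "'l set" and F :: "'l \<Rightarrow> complex^2^2"
    and \<psi> \<phi> \<psi>' \<phi>' :: "complex^2"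
    and r :: real
  assumes "ancilla_free_measurement \<xi> \<rho> \<Omega>\<^sub>E E"
    and "ancilla_free_measurement \<xi>' \<tau> \<Omega>\<^sub>F F"
    and "M \<subseteq> \<Omega>\<^sub>E" and "N \<subseteq> \<Omega>\<^sub>F"
    and "0 < r" and "r < 1"
    and "max_eigenvector \<rho> \<psi>" and "max_eigenvector \<tau> \<phi>"
    and "max_eigenvector (\<Sum>m\<in>M. E m) \<psi>'" and "max_eigenvector (\<Sum>n\<in>N. F n) \<phi>'"
  shows
    "(nondegenerate_max \<rho> \<and> nondegenerate_max \<tau> \<and>
      nondegenerate_max (\<Sum>m\<in>M. E m) \<and> nondegenerate_max (\<Sum>n\<in>N. F n) \<longrightarrow>
        (C_bound r \<xi> \<rho> E M \<xi>' \<tau> F N < T_bound r \<xi> \<rho> E M \<xi>' \<tau> F N \<longleftrightarrow>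
         cmod (cinner \<psi> \<phi>) \<noteq> cmod (cinner \<psi>' \<phi>')))
     \<and>
     (C_bound r \<xi> \<rho> E M \<xi>' \<tau> F N < T_bound r \<xi> \<rho> E M \<xi>' \<tau> F N \<longleftrightarrow>
        (\<forall>\<alpha> \<beta> \<alpha>' \<beta>'. max_eigenvector \<rho> \<alpha> \<and> max_eigenvector \<tau> \<beta> \<and>
           max_eigenvector (\<Sum>m\<in>M. E m) \<alpha>' \<and> max_eigenvector (\<Sum>n\<in>N. F n) \<beta>' \<longrightarrow>
           cmod (cinner \<alpha> \<beta>) \<noteq> cmod (cinner \<alpha>' \<beta>')))"
proof -
  note meas = assms(1,2)[unfolded ancilla_free_measurement_def density_operator_def povm_def]
  define A where "A = (\<Sum>m\<in>M. E m)"
  define B where "B = (\<Sum>n\<in>N. F n)"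
  have tr: "trace \<xi> = 1" "trace \<xi>' = 1" using meas by auto
  have herm: "adj \<rho> = \<rho>" "adj \<tau> = \<tau>" "adj A = A" "adj B = B"
    unfolding A_def B_def using meas assms(3,4) by (auto intro!: adj_psd adj_sum_psd)
  have evs: "max_eigenvector \<rho> \<psi>" "max_eigenvector \<tau> \<phi>" "max_eigenvector A \<psi>'" "max_eigenvector B \<phi>'"
    using assms unfolding A_def B_def by blast+
  let ?s = "success A \<rho>" and ?t = "success B \<tau>"
  let ?C = "C_bound r \<xi> \<rho> E M \<xi>' \<tau> F N" and ?T = "T_bound r \<xi> \<rho> E M \<xi>' \<tau> F N"
  \<comment> \<open>\<open>V\<close> and \<open>W\<close> are optimal for the measurements
    separately, \<open>X\<close> for their mixture; the bounds coincide exactly when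
    \<open>X\<close> is optimal for both.\<close>
  obtain V where V: "unitary V" "\<And>U. unitary U \<Longrightarrow> ?s U \<le> ?s V"
    and maxV: "max_over_channels (\<lambda>\<Lambda>. \<Sum>m\<in>M. outcome_prob \<xi> \<rho> E \<Lambda> m) = ?s V"
    by (rule max_over_channels_attained[OF sum_outcome_prob[where E = E and M = M and \<rho> = \<rho>, OF tr(1)] continuous_on_success, folded A_def]) (blast intro: that)
  obtain W where W: "unitary W" "\<And>U. unitary U \<Longrightarrow> ?t U \<le> ?t W"
    and maxW: "max_over_channels (\<lambda>\<Lambda>. \<Sum>n\<in>N. outcome_prob \<xi>' \<tau> F \<Lambda> n) = ?t W"
    by (rule max_over_channels_attained[OF sum_outcome_prob[where E = F and M = N and \<rho> = \<tau>, OF tr(2)] continuous_on_success, folded B_def]) (blast intro: that)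
  obtain X where X: "unitary X" "\<And>U. unitary U \<Longrightarrow> r * ?s U + (1 - r) * ?t U \<le> r * ?s X + (1 - r) * ?t X"
    and C: "?C = r * ?s X + (1 - r) * ?t X"
    unfolding C_bound_def
  proof (rule max_over_channels_attained[of
        "\<lambda>\<Lambda>. r * (\<Sum>m\<in>M. outcome_prob \<xi> \<rho> E \<Lambda> m) + (1 - r) * (\<Sum>n\<in>N. outcome_prob \<xi>' \<tau> F \<Lambda> n)"
        "\<lambda>U. r * ?s U + (1 - r) * ?t U"])
    show "r * (\<Sum>m\<in>M. outcome_prob \<xi> \<rho> E (\<lambda>X. \<Sum>x<k. p x *\<^sub>R (U x ** X ** adj (U x))) m)
        + (1 - r) * (\<Sum>n\<in>N. outcome_prob \<xi>' \<tau> F (\<lambda>X. \<Sum>x<k. p x *\<^sub>R (U x ** X ** adj (U x))) n)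
        = (\<Sum>x<k. p x * (r * ?s (U x) + (1 - r) * ?t (U x)))" for k :: nat and p U
      unfolding A_def B_def sum_outcome_prob[OF tr(1)] sum_outcome_prob[OF tr(2)]
      by (simp add: distrib_left sum.distrib sum_distrib_left mult.left_commute)
    show "continuous_on (Collect unitary) (\<lambda>U. r * ?s U + (1 - r) * ?t U)"
      by (intro continuous_intros continuous_on_success)
  qed (blast intro: that)
  have T: "?T = r * ?s V + (1 - r) * ?t W"
    unfolding T_bound_def maxV maxW ..
  have main: "?C < ?T \<longleftrightarrow>
        (\<forall>\<alpha> \<beta> \<alpha>' \<beta>'. max_eigenvector \<rho> \<alpha> \<and> max_eigenvector \<tau> \<beta> \<and>
           max_eigenvector A \<alpha>' \<and> max_eigenvector B \<beta>' \<longrightarrow>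
           cmod (cinner \<alpha> \<beta>) \<noteq> cmod (cinner \<alpha>' \<beta>'))" (is "_ \<longleftrightarrow> ?R")
  proof (intro iffI allI impI notI; (elim conjE)?)
    fix \<alpha> \<beta> \<alpha>' \<beta>'
    assume "?C < ?T" and max: "max_eigenvector \<rho> \<alpha>" "max_eigenvector \<tau> \<beta>"
        "max_eigenvector A \<alpha>'" "max_eigenvector B \<beta>'"
      and overlap: "cmod (cinner \<alpha> \<beta>) = cmod (cinner \<alpha>' \<beta>')"
    then obtain U where U: "unitary U" "cmod (cinner \<alpha>' (U *v \<alpha>)) = 1" "cmod (cinner \<beta>' (U *v \<beta>)) = 1"
      using exists_unitary_aligning[of \<alpha> \<beta> \<alpha>' \<beta>'] unfolding max_eigenvector_def by blast
    \<comment> \<open>The aligning unitary is optimal for both measurements at once, so the mixture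
      reaches \<open>?T\<close>.\<close>
    have "?s V \<le> ?s U" "?t W \<le> ?t U"
      using success_aligned_max U V(1) W(1) herm max by blast+
    then have "r * ?s V + (1 - r) * ?t W \<le> r * ?s U + (1 - r) * ?t U"
      using assms(5,6) by (intro add_mono mult_left_mono) auto
    also have "\<dots> \<le> ?C" using X(2)[OF U(1)] C by simp
    finally show False using \<open>?C < ?T\<close> T by simp
  next
    assume ?R
    show "?C < ?T"
    proof (rule ccontr)
      assume "\<not> ?C < ?T"
      \<comment> \<open>Two nonnegative gaps with sum at most 0 vanish, and the strict bounds on
        \<open>r\<close> allow cancelling the weights.\<close>
      then have "r * (?s V - ?s X) + (1 - r) * (?t W - ?t X) \<le> 0"
        unfolding C T by (simp add: algebra_simps)
      moreover have "0 \<le> r * (?s V - ?s X)" "0 \<le> (1 - r) * (?t W - ?t X)"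
        using V(2)[OF X(1)] W(2)[OF X(1)] assms(5,6) by simp_all
      ultimately have "r * (?s V - ?s X) = 0" "(1 - r) * (?t W - ?t X) = 0" by linarith+
      then have "?s X = ?s V" "?t X = ?t W" using assms(5,6) by simp_all
      then obtain \<alpha> \<alpha>' \<beta> \<beta>' where max: "max_eigenvector \<rho> \<alpha>" "max_eigenvector A \<alpha>'"
          "max_eigenvector \<tau> \<beta>" "max_eigenvector B \<beta>'"
        and aligned: "cmod (cinner \<alpha>' (X *v \<alpha>)) = 1" "cmod (cinner \<beta>' (X *v \<beta>)) = 1"
        using success_max_aligned[OF herm(3,1) evs(3,1) X(1)] V(2)
          success_max_aligned[OF herm(4,2) evs(4,2) X(1)] W(2) by metis
      then have "cmod (cinner \<alpha> \<beta>) = cmod (cinner \<alpha>' \<beta>')"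
        using X(1) by (intro cmod_cinner_eq_of_aligned) (auto simp: max_eigenvector_def)
      then show False using \<open>?R\<close> max by blast
    qed
  qed
  \<comment> \<open>Under nondegeneracy every choice of eigenvectors has the overlaps of the given
    ones, so the quantifiers collapse.\<close>
  moreover have "?R \<longleftrightarrow> cmod (cinner \<psi> \<phi>) \<noteq> cmod (cinner \<psi>' \<phi>')"
    if "nondegenerate_max \<rho>" "nondegenerate_max \<tau>" "nondegenerate_max A" "nondegenerate_max B"
    using cmod_cinner_nondegenerate[OF that(1) evs(1) _ that(2) evs(2)]
      cmod_cinner_nondegenerate[OF that(3) evs(3) _ that(4) evs(4)] evs by metis
  ultimately show ?thesis
    unfolding A_def B_def by blast
qed

end
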